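(* Let $c\in\mathbb{C}$, let $U\subset\mathbb{C}$ be open, and suppose that a contour $[0,1]\ni\tau\mapsto\gamma(\tau)$ satisfies, for every $z\in U$, $$e^te^{\frac{z}{t}}t^{-c}\Big|_{t=\gamma(0)}^{t=\gamma(1)}=0.$$ Then, for $z\in U$, $$\big(z\partial_z^2+c\,\partial_z-1\big)\int_\gamma e^te^{\frac{z}{t}}t^{-c}\,dt=0.$$
   Context: The operator $\mathcal{F}(c;z,\partial_z):=z\partial_z^2+c\,\partial_z-1$ is the ${}_0F_1$ operator. Notation: $f(t)\big|_{t=\gamma(0)}^{t=\gamma(1)}$ denotes $f(\gamma(1))-f(\gamma(0))$, where multivalued functions are continued analytically along $\gamma$ (so for a closed contour the two values may differ). Conventions on contours: $\gamma$ does not depend on $z\in U$; it is piecewise smooth on $]0,1[$ and there avoids $0$. The branch of $t^{-c}$ is fixed by a continuous choice of the logarithm of $t$ along $\gamma$, the same in the integrand and in the boundary condition. Endpoints may be $0$ or infinity, in which case values there mean limits along $\gamma$. The integral is assumed to converge and to be twice differentiable in $z\in U$ under the integral sign. *)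

theory Defs
  imports "HOL-Complex_Analysis.Complex_Analysis"
begin

text \<open>
  A contour is given by a parametrisation whose values matter only on the open interval
  \<open>]0,1[\<close>. Its endpoints are the limits at \<open>0\<close> and \<open>1\<close>, each a complex number (possibly \<open>0\<close>)
  or infinity. The pieces are required to be finite in number only on compact subintervals, so
  they may accumulate at the endpoints.
\<close>

definition has_endpoint :: "(real \<Rightarrow> complex) \<Rightarrow> real filter \<Rightarrow> bool" where
  "has_endpoint \<gamma> F \<longleftrightarrow> (\<exists>p. (\<gamma> \<longlongrightarrow> p) F) \<or> filterlim \<gamma> at_infinity F"

definition contour :: "(real \<Rightarrow> complex) \<Rightarrow> bool" where
  "contour \<gamma> \<longleftrightarrow>
     (\<forall>a b. 0 < a \<longrightarrow> a \<le> b \<longrightarrow> b < 1 \<longrightarrow> \<gamma> piecewise_C1_differentiable_on {a..b}) \<and>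
     (\<forall>\<tau>\<in>{0<..<1}. \<gamma> \<tau> \<noteq> 0) \<and>
     has_endpoint \<gamma> (at_right 0) \<and> has_endpoint \<gamma> (at_left 1)"

definition log_along :: "(real \<Rightarrow> complex) \<Rightarrow> (real \<Rightarrow> complex) \<Rightarrow> bool" where
  "log_along \<gamma> L \<longleftrightarrow> continuous_on {0<..<1} L \<and> (\<forall>\<tau>\<in>{0<..<1}. exp (L \<tau>) = \<gamma> \<tau>)"

text \<open>
  The function \<open>e\<^sup>t e\<^bsup>z/t\<^esup> t\<^bsup>-c\<^esup>\<close> at \<open>t = \<gamma> \<tau>\<close>. It is multivalued in \<open>t\<close>, hence a function of the
  parameter \<open>\<tau>\<close>, with \<open>t\<^bsup>-c\<^esup>\<close> determined by the logarithm \<open>L\<close>.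
\<close>

definition bessel_kernel ::
    "complex \<Rightarrow> (real \<Rightarrow> complex) \<Rightarrow> (real \<Rightarrow> complex) \<Rightarrow> complex \<Rightarrow> real \<Rightarrow> complex" where
  "bessel_kernel c \<gamma> L z \<tau> = exp (\<gamma> \<tau>) * exp (z / \<gamma> \<tau>) * exp (- c * L \<tau>)"

text \<open>
  \<open>has_boundary_difference f d\<close>: both endpoint values of \<open>f\<close> exist, as limits along the contour,
  and \<open>d\<close> is the final one minus the initial one. At a finite nonzero endpoint the limit is the
  value of the continued function there.
\<close>

definition has_boundary_difference :: "(real \<Rightarrow> complex) \<Rightarrow> complex \<Rightarrow> bool" where
  "has_boundary_difference f d \<longleftrightarrow>
     (\<exists>a b. (f \<longlongrightarrow> a) (at_right 0) \<and> (f \<longlongrightarrow> b) (at_left 1) \<and> d = b - a)"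

text \<open>
  The integral along \<open>\<gamma>\<close> of a function given in terms of the parameter. The library's
  \<open>contour_integral\<close> does not apply, since its integrand must be a single-valued function of
  the point \<open>t\<close>. The Henstock-Kurzweil integral includes the conditionally convergent improper
  integrals that arise when an endpoint is \<open>0\<close> or infinity.
\<close>

definition converges_along :: "(real \<Rightarrow> complex) \<Rightarrow> (real \<Rightarrow> complex) \<Rightarrow> bool" where
  "converges_along \<gamma> f \<longleftrightarrow>
     (\<lambda>\<tau>. f \<tau> * vector_derivative \<gamma> (at \<tau>)) integrable_on {0<..<1}"

definition integral_along :: "(real \<Rightarrow> complex) \<Rightarrow> (real \<Rightarrow> complex) \<Rightarrow> complex" where
  "integral_along \<gamma> f = integral {0<..<1} (\<lambda>\<tau>. f \<tau> * vector_derivative \<gamma> (at \<tau>))"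

definition deriv_param :: "(complex \<Rightarrow> real \<Rightarrow> complex) \<Rightarrow> complex \<Rightarrow> real \<Rightarrow> complex" where
  "deriv_param f z \<tau> = deriv (\<lambda>w. f w \<tau>) z"

definition differentiable_under_integral ::
    "(real \<Rightarrow> complex) \<Rightarrow> complex set \<Rightarrow> (complex \<Rightarrow> real \<Rightarrow> complex) \<Rightarrow> bool" where
  "differentiable_under_integral \<gamma> U f \<longleftrightarrow>
     (\<forall>z\<in>U. converges_along \<gamma> (f z) \<and> converges_along \<gamma> (deriv_param f z) \<and>
        ((\<lambda>w. integral_along \<gamma> (f w)) has_field_derivative
           integral_along \<gamma> (deriv_param f z)) (at z))"

definition twice_differentiable_under_integral ::
    "(real \<Rightarrow> complex) \<Rightarrow> complex set \<Rightarrow> (complex \<Rightarrow> real \<Rightarrow> complex) \<Rightarrow> bool" where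
  "twice_differentiable_under_integral \<gamma> U f \<longleftrightarrow>
     differentiable_under_integral \<gamma> U f \<and> differentiable_under_integral \<gamma> U (deriv_param f)"

definition hyp0F1_operator :: "complex \<Rightarrow> (complex \<Rightarrow> complex) \<Rightarrow> complex \<Rightarrow> complex" where
  "hyp0F1_operator c u z = z * deriv (deriv u) z + c * deriv u z - u z"

end

theory Submission
  imports Defs
begin

text \<open>
  Write \<open>K = e\<^sup>t e\<^bsup>z/t\<^esup> t\<^bsup>-c\<^esup>\<close>. Each derivative in \<open>z\<close> divides \<open>K\<close> by \<open>t\<close>, so applying the operator
  under the integral sign turns the integrand into \<open>K (z/t\<^sup>2 + c/t - 1)\<close>, which is exactly
  \<open>- \<partial>K/\<partial>t\<close>. The integral of this total derivative is minus the boundary difference of \<open>K\<close>, and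
  that vanishes by assumption.

  Two points need care. Along the contour \<open>K\<close> is a function of the parameter only, and \<open>t\<^bsup>-c\<^esup>\<close> is
  given through a logarithm \<open>L\<close> assumed merely continuous; \<open>continuous_log_has_vector_derivative\<close>
  shows that \<open>L\<close> is differentiable wherever \<open>\<gamma>\<close> is. Moreover, the break points of \<open>\<gamma>\<close> may
  accumulate at the endpoints, where \<open>K\<close> has limits only, so the fundamental theorem of calculus
  is applied on compact subintervals and extended by \<open>integral_eq_boundary_limits\<close>, using
  that indefinite Henstock-Kurzweil integrals are continuous up to the endpoints.
\<close>

text \<open>
  The difference between the indefinite integral of \<open>f\<close> and \<open>F\<close> is constant in the interior;
  comparing its limits at the two ends gives the claim.
\<close>

lemma integral_eq_boundary_limits:
  fixes f F :: "real \<Rightarrow> 'a::euclidean_space"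
  assumes "p < q"
    and int: "f integrable_on {p<..<q}"
    and ftc: "\<And>x y. p < x \<Longrightarrow> x \<le> y \<Longrightarrow> y < q \<Longrightarrow> (f has_integral (F y - F x)) {x..y}"
    and lim_p: "(F \<longlongrightarrow> a) (at_right p)"
    and lim_q: "(F \<longlongrightarrow> b) (at_left q)"
  shows "integral {p<..<q} f = b - a"
proof -
  define I where "I x = integral {p..x} f" for x
  define m where "m = (p + q) / 2"
  have m: "p < m" "m < q"
    using \<open>p < q\<close> by (auto simp: m_def)
  have int': "f integrable_on {p..q}"
    using int integrable_on_Icc_iff_Ioo by blast
  have cont: "continuous_on {p..q} I"
    unfolding I_def using int' by (rule indefinite_integral_continuous_1)
  have step: "I y - F y = I x - F x" if "p < x" "x \<le> y" "y < q" for x y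
  proof -
    have "f integrable_on {p..y}"
      using int' that by (auto intro: integrable_on_subinterval)
    then have "I x + integral {x..y} f = I y"
      unfolding I_def using that by (intro Henstock_Kurzweil_Integration.integral_combine) auto
    then show ?thesis
      using integral_unique[OF ftc[OF that]] by (simp add: algebra_simps)
  qed
  have const: "I x - F x = I m - F m" if "p < x" "x < q" for x
    using step[of x m] step[of m x] that m by (cases "x \<le> m") auto
  have "(I \<longlongrightarrow> I p) (at_right p)" "(I \<longlongrightarrow> I q) (at_left q)"
    using cont \<open>p < q\<close> by (auto simp: continuous_on_Icc_at_rightD continuous_on_Icc_at_leftD)
  then have "((\<lambda>x. I x - F x) \<longlongrightarrow> I p - a) (at_right p)"
    "((\<lambda>x. I x - F x) \<longlongrightarrow> I q - b) (at_left q)"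
    using lim_p lim_q by (auto intro: tendsto_diff)
  moreover have "\<forall>\<^sub>F x in at_right p. I x - F x = I m - F m"
    "\<forall>\<^sub>F x in at_left q. I x - F x = I m - F m"
    using const \<open>p < q\<close> by (auto simp: eventually_at_right[OF \<open>p < q\<close>] eventually_at_left[OF \<open>p < q\<close>])
  ultimately have "I p - a = I m - F m" "I q - b = I m - F m"
    by (metis tendsto_unique tendsto_eventually trivial_limit_at_right_real,
        metis tendsto_unique tendsto_eventually trivial_limit_at_left_real)
  moreover have "I p = 0" "I q = integral {p<..<q} f"
    by (auto simp: I_def integral_open_interval_real)
  ultimately show ?thesis
    by (simp add: algebra_simps)
qed

text \<open>
  Near a point \<open>x\<close> the increment \<open>L y - L x\<close> is small, so it is the principal logarithm of
  \<open>\<gamma> y / \<gamma> x\<close>, whatever branch \<open>L\<close> follows.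
\<close>

lemma continuous_log_has_vector_derivative:
  fixes \<gamma> L :: "real \<Rightarrow> complex"
  assumes "open S" "x \<in> S" and cont: "continuous_on S L"
    and log: "\<And>y. y \<in> S \<Longrightarrow> exp (L y) = \<gamma> y"
    and der: "(\<gamma> has_vector_derivative D) (at x)"
  shows "(L has_vector_derivative D / \<gamma> x) (at x)"
proof -
  have nz: "\<gamma> x \<noteq> 0"
    using log[OF \<open>x \<in> S\<close>] by (metis exp_not_eq_zero)
  have "(L \<longlongrightarrow> L x) (nhds x)"
    using cont \<open>open S\<close> \<open>x \<in> S\<close>
    by (simp add: continuous_on_eq_continuous_at continuous_at tendsto_nhds_iff)
  then have "\<forall>\<^sub>F y in nhds x. dist (L y) (L x) < pi"
    by (rule tendstoD) simp
  then obtain T where T: "open T" "x \<in> T" "\<And>y. y \<in> T \<Longrightarrow> dist (L y) (L x) < pi"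
    by (auto simp: eventually_nhds)
  have eq: "L x + Ln (\<gamma> y / \<gamma> x) = L y" if "y \<in> S \<inter> T" for y
  proof -
    have "\<bar>Im (L y - L x)\<bar> < pi"
      using abs_Im_le_cmod[of "L y - L x"] T(3)[of y] that by (auto simp: dist_norm)
    then have "Ln (exp (L y - L x)) = L y - L x"
      by (intro Ln_exp) auto
    then show ?thesis
      using log[of x] log[of y] that \<open>x \<in> S\<close> by (simp add: exp_diff)
  qed
  have quot: "((\<lambda>y. \<gamma> y / \<gamma> x) has_vector_derivative D / \<gamma> x) (at x)"
    using has_vector_derivative_mult_left[OF der, of "inverse (\<gamma> x)"]
    by (simp add: divide_inverse)
  have "(Ln has_field_derivative inverse (\<gamma> x / \<gamma> x)) (at (\<gamma> x / \<gamma> x))"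
    using nz by (intro has_field_derivative_Ln) auto
  from field_vector_diff_chain_at[OF quot this]
  have "((\<lambda>y. Ln (\<gamma> y / \<gamma> x)) has_vector_derivative D / \<gamma> x) (at x)"
    using nz by (simp add: o_def)
  from has_vector_derivative_add[OF has_vector_derivative_const this]
  have "((\<lambda>y. L x + Ln (\<gamma> y / \<gamma> x)) has_vector_derivative D / \<gamma> x) (at x)"
    by simp
  then show ?thesis
    by (rule has_vector_derivative_transform_within_open[where S = "S \<inter> T"])
      (use \<open>open S\<close> \<open>x \<in> S\<close> T eq in auto)
qed

lemma bessel_kernel_has_field_derivative_param:
  "((\<lambda>w. bessel_kernel c \<gamma> L w \<tau>) has_field_derivative bessel_kernel c \<gamma> L z \<tau> / \<gamma> \<tau>) (at z)"
proof -
  have "((\<lambda>w. exp (w / \<gamma> \<tau>)) has_field_derivative exp (z / \<gamma> \<tau>) * (1 / \<gamma> \<tau>)) (at z)"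
    by (rule DERIV_chain2[OF DERIV_exp DERIV_cdivide[OF DERIV_ident]])
  then show ?thesis
    unfolding bessel_kernel_def
    using DERIV_cmult_right[OF DERIV_cmult[of _ _ _ _ "exp (\<gamma> \<tau>)"], of _ _ _ _ "exp (- c * L \<tau>)"]
    by fastforce
qed

lemma deriv_param_bessel_kernel:
  "deriv_param (bessel_kernel c \<gamma> L) = (\<lambda>z \<tau>. bessel_kernel c \<gamma> L z \<tau> / \<gamma> \<tau>)"
  unfolding deriv_param_def
  by (intro ext DERIV_imp_deriv bessel_kernel_has_field_derivative_param)

lemma deriv_param_deriv_param_bessel_kernel:
  "deriv_param (deriv_param (bessel_kernel c \<gamma> L)) =
     (\<lambda>z \<tau>. bessel_kernel c \<gamma> L z \<tau> / (\<gamma> \<tau>)\<^sup>2)"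
  unfolding deriv_param_bessel_kernel unfolding deriv_param_def
  using DERIV_cdivide[OF bessel_kernel_has_field_derivative_param]
  by (intro ext DERIV_imp_deriv) (simp add: power2_eq_square)

text \<open>
  The factor multiplying the kernel is the negative of the one that the differential operator
  produces under the integral sign.
\<close>

lemma bessel_kernel_has_vector_derivative:
  assumes log: "log_along \<gamma> L" and \<tau>: "\<tau> \<in> {0<..<1}"
    and der: "(\<gamma> has_vector_derivative D) (at \<tau>)"
  shows "(bessel_kernel c \<gamma> L z has_vector_derivative
           bessel_kernel c \<gamma> L z \<tau> * (1 - z / (\<gamma> \<tau>)\<^sup>2 - c / \<gamma> \<tau>) * D) (at \<tau>)"
proof -
  have nz: "\<gamma> \<tau> \<noteq> 0"
    using log \<tau> by (metis log_along_def exp_not_eq_zero)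
  have L: "(L has_vector_derivative D / \<gamma> \<tau>) (at \<tau>)"
    using log der \<tau>
    by (intro continuous_log_has_vector_derivative[where S = "{0<..<1}"])
      (auto simp: log_along_def)
  have "((\<lambda>t. exp t * exp (z / t)) has_field_derivative
          exp (\<gamma> \<tau>) * exp (z / \<gamma> \<tau>) * (1 - z / (\<gamma> \<tau>)\<^sup>2)) (at (\<gamma> \<tau>))"
    using nz by (auto intro!: derivative_eq_intros simp: field_simps power2_eq_square)
  from field_vector_diff_chain_at[OF der this]
  have E: "((\<lambda>s. exp (\<gamma> s) * exp (z / \<gamma> s)) has_vector_derivative
          D * (exp (\<gamma> \<tau>) * exp (z / \<gamma> \<tau>) * (1 - z / (\<gamma> \<tau>)\<^sup>2))) (at \<tau>)"
    by (simp add: o_def)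
  have "((\<lambda>l. exp (- c * l)) has_field_derivative - c * exp (- c * L \<tau>)) (at (L \<tau>))"
    by (auto intro!: derivative_eq_intros)
  from field_vector_diff_chain_at[OF L this]
  have P: "((\<lambda>s. exp (- c * L s)) has_vector_derivative
          D / \<gamma> \<tau> * (- c * exp (- c * L \<tau>))) (at \<tau>)"
    by (simp add: o_def)
  show ?thesis
    unfolding bessel_kernel_def using has_vector_derivative_mult[OF E P]
    by (rule has_vector_derivative_eq_rhs) (simp add: algebra_simps)
qed

text \<open>
  Only finitely many break points of \<open>\<gamma>\<close> lie in a compact subinterval, and the kernel is continuous
  across them.
\<close>

lemma bessel_kernel_derivative_has_integral:
  assumes con: "contour \<gamma>" and log: "log_along \<gamma> L" and xy: "0 < x" "x \<le> y" "y < 1"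
  shows "((\<lambda>\<tau>. bessel_kernel c \<gamma> L z \<tau> * (1 - z / (\<gamma> \<tau>)\<^sup>2 - c / \<gamma> \<tau>)
             * vector_derivative \<gamma> (at \<tau>)) has_integral
          bessel_kernel c \<gamma> L z y - bessel_kernel c \<gamma> L z x) {x..y}"
proof -
  have "\<gamma> piecewise_C1_differentiable_on {x..y}"
    using con xy by (auto simp: contour_def)
  then obtain B where cont: "continuous_on {x..y} \<gamma>" and "finite B"
    and C1: "\<gamma> C1_differentiable_on ({x..y} - B)"
    by (auto simp: piecewise_C1_differentiable_on_def)
  have "continuous_on {x..y} L"
    using log xy by (auto simp: log_along_def intro: continuous_on_subset)
  moreover have "\<forall>\<tau>\<in>{x..y}. \<gamma> \<tau> \<noteq> 0"
    using con xy by (auto simp: contour_def)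
  ultimately have "continuous_on {x..y} (bessel_kernel c \<gamma> L z)"
    unfolding bessel_kernel_def using cont by (intro continuous_intros) auto
  moreover have "(bessel_kernel c \<gamma> L z has_vector_derivative
      bessel_kernel c \<gamma> L z \<tau> * (1 - z / (\<gamma> \<tau>)\<^sup>2 - c / \<gamma> \<tau>) * vector_derivative \<gamma> (at \<tau>)) (at \<tau>)"
    if "\<tau> \<in> {x<..<y} - B" for \<tau>
    using C1 that xy
    by (intro bessel_kernel_has_vector_derivative[OF log])
      (auto simp: C1_differentiable_on_eq vector_derivative_works)
  ultimately show ?thesis
    using \<open>finite B\<close> xy by (intro fundamental_theorem_of_calculus_interior_strong) auto
qed

lemma deriv_integral_along:
  assumes "differentiable_under_integral \<gamma> U f" "z \<in> U"
  shows "deriv (\<lambda>w. integral_along \<gamma> (f w)) z = integral_along \<gamma> (deriv_param f z)"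
  using assms by (auto simp: differentiable_under_integral_def intro: DERIV_imp_deriv)

theorem theorem5p1:
  fixes c :: complex and U :: "complex set" and \<gamma> L :: "real \<Rightarrow> complex"
  assumes "open U"
    and "contour \<gamma>"
    and "log_along \<gamma> L"
    and "\<forall>z\<in>U. converges_along \<gamma> (bessel_kernel c \<gamma> L z)"
    and "twice_differentiable_under_integral \<gamma> U (bessel_kernel c \<gamma> L)"
    and "\<forall>z\<in>U. has_boundary_difference (bessel_kernel c \<gamma> L z) 0"
  shows "\<forall>z\<in>U. hyp0F1_operator c (\<lambda>w. integral_along \<gamma> (bessel_kernel c \<gamma> L w)) z = 0"
proof
  fix z assume z: "z \<in> U"
  let ?K = "bessel_kernel c \<gamma> L"
  let ?u = "\<lambda>w. integral_along \<gamma> (?K w)"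
  let ?D = "\<lambda>\<tau>. vector_derivative \<gamma> (at \<tau>)"
  let ?int_u = "\<lambda>\<tau>. ?K z \<tau> * ?D \<tau>"
  let ?int_du = "\<lambda>\<tau>. ?K z \<tau> / \<gamma> \<tau> * ?D \<tau>"
  let ?int_ddu = "\<lambda>\<tau>. ?K z \<tau> / (\<gamma> \<tau>)\<^sup>2 * ?D \<tau>"
  let ?int_dK = "\<lambda>\<tau>. ?K z \<tau> * (1 - z / (\<gamma> \<tau>)\<^sup>2 - c / \<gamma> \<tau>) * ?D \<tau>"
  have diff: "differentiable_under_integral \<gamma> U ?K"
    "differentiable_under_integral \<gamma> U (deriv_param ?K)"
    using assms(5) by (auto simp: twice_differentiable_under_integral_def)
  have u1: "deriv ?u w = integral_along \<gamma> (deriv_param ?K w)" if "w \<in> U" for w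
    using diff(1) that by (rule deriv_integral_along)
  have "\<forall>\<^sub>F w in nhds z. deriv ?u w = integral_along \<gamma> (deriv_param ?K w)"
    using u1 eventually_nhds_in_open[OF \<open>open U\<close> z] by (auto elim: eventually_mono)
  then have "deriv (deriv ?u) z = deriv (\<lambda>w. integral_along \<gamma> (deriv_param ?K w)) z"
    by (rule deriv_cong_ev) simp
  also have "\<dots> = integral_along \<gamma> (deriv_param (deriv_param ?K) z)"
    using diff(2) z by (rule deriv_integral_along)
  finally have u2: "deriv (deriv ?u) z = integral {0<..<1} ?int_ddu"
    by (simp add: integral_along_def deriv_param_deriv_param_bessel_kernel)
  have u1': "deriv ?u z = integral {0<..<1} ?int_du"
    using u1[OF z] by (simp add: integral_along_def deriv_param_bessel_kernel)
  have "converges_along \<gamma> (?K z)" "converges_along \<gamma> (deriv_param ?K z)"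
    "converges_along \<gamma> (deriv_param (deriv_param ?K) z)"
    using diff z by (auto simp: differentiable_under_integral_def)
  then have "?int_u integrable_on {0<..<1}" "?int_du integrable_on {0<..<1}"
    "?int_ddu integrable_on {0<..<1}"
    unfolding converges_along_def deriv_param_deriv_param_bessel_kernel
    unfolding deriv_param_bessel_kernel .
  then have "((\<lambda>\<tau>. ?int_u \<tau> - z * ?int_ddu \<tau> - c * ?int_du \<tau>) has_integral
      integral {0<..<1} ?int_u - z * integral {0<..<1} ?int_ddu - c * integral {0<..<1} ?int_du) {0<..<1}"
    by (intro has_integral_diff has_integral_mult_right integrable_integral)
  also have "(\<lambda>\<tau>. ?int_u \<tau> - z * ?int_ddu \<tau> - c * ?int_du \<tau>) = ?int_dK"
    by (simp add: algebra_simps)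
  also have "integral {0<..<1} ?int_u - z * integral {0<..<1} ?int_ddu - c * integral {0<..<1} ?int_du
      = - hyp0F1_operator c ?u z"
    unfolding hyp0F1_operator_def u2 u1' by (simp add: integral_along_def)
  finally have total: "(?int_dK has_integral - hyp0F1_operator c ?u z) {0<..<1}" .
  obtain a where "(?K z \<longlongrightarrow> a) (at_right 0)" "(?K z \<longlongrightarrow> a) (at_left 1)"
    using assms(6) z by (auto simp: has_boundary_difference_def)
  with total have "integral {0<..<1} ?int_dK = a - a"
    by (intro integral_eq_boundary_limits[where F = "?K z"]
        bessel_kernel_derivative_has_integral[OF assms(2,3)]) auto
  with integral_unique[OF total] show "hyp0F1_operator c ?u z = 0"
    by simp
qed

end
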